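(* Suppose that for all contracts $(l,t,BU)$ the utility is $U^{BU}_{k,l,t}=Y^{BU}_{k,l,t}+X_k$, where $Y^{BU}_{k,l,t}$ is a constant known to the charging station and $X_k$ is a random variable whose realized value is not known to the charging station. Let $$\zeta=\max\Big\{\gamma\;\Big|\;\gamma\in\operatorname{argmax}_{\beta\ge0}\;\beta\max_{i,j,b}\Pr\big(U^{b}_{k,i,j}\ge\beta+v^{b}_{i,j}-v_{-k}\big)\Big\},$$ and assume $\zeta$ exists. Then the pricing strategy $p^{BU}_{k,l,t}=v^{BU}_{l,t}-v_{-k}+\zeta$ (for every contract $(l,t,BU)$) maximizes the expected profit of the charging station, $$\sum_{BU}\sum_{l}\sum_{t}\big(p^{BU}_{k,l,t}-v^{BU}_{l,t}+v_{-k}\big)\Pr(R^{BU}_{k,l,t}),$$ where $R^{BU}_{k,l,t}$ is the event that user $k$ accepts contract $(l,t,BU)$.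
   Context: User $k$ arrives at a charging station at time $t_k$ and is offered contracts $(l,t,BU)$ with $l\in\{1,\dots,L\}$ (energy), $t\in\{t_k+1,\dots,T\}$ (deadline), $BU\in\{0,\dots,BU_{max}\}$ (maximum additional battery utilization), at prices $p^{BU}_{k,l,t}$. User: the utility of contract $(l,t,BU)$ is a random variable $U^{BU}_{k,l,t}$ with realized value $u^{BU}_{k,l,t}$, known to the user only. Her payoff from the contract is $u^{BU}_{k,l,t}-p^{BU}_{k,l,t}$, and $0$ if she rejects all. She selects a contract of maximum payoff; if the maximum payoff over contracts is negative she rejects all, and if it is $0$ she accepts (ties between accepting and rejecting are resolved by accepting). Among several maximum-payoff contracts any convex combination may be chosen. Station: $v^{BU}_{l,t}$ is the optimal value of the linear program $\mathcal P^{BU}_{l,t}$ below (equal to $\infty$ if infeasible), and $v_{-k}$ is the optimal value when user $k$ accepts no contract, i.e. of the same program with $r_{k,t}=0$ and only the requirements of the existing vehicles. These do not depend on the prices. The station's profit is $p^{BU}_{k,l,t}-v^{BU}_{l,t}+v_{-k}$ if $(l,t,BU)$ is selected and $0$ if none is. Linear program $\mathcal P^{BU}_{l,t_{\text{dead}}}$. $\mathcal K_0$: finite set of vehicles (EVs) already present; $i\in\mathcal K_0$ needs energy $N_i$ by deadline $w_i$ with remaining utilization allowance $BU_i$; put $N_k=l$, $w_k=t_{\text{dead}}$, $BU_k=BU$. Data: EV efficiencies $\eta_{i,c},\eta_{i,dc}\le1$, levels $\text{EV}^{i,\mathrm{ini}}$ at $t_k$, bounds $d_{i,\min},d_{i,\max}$,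 rate limits $R_{min},R_{max}$, harvested energy $\bar E^t$, storage capacity $B_{max}$, initial storage level $B^0$, station efficiencies $\eta_{c,cs},\eta_{d,cs}$, unit buying and selling prices $c_t\ge g_t$. Minimize $\sum_{t=t_k}^{T-1}(c_tq_t-g_tx_t)$ over $q_t,x_t,e_t,s_t,r^+_{i,t},r^-_{i,t}\ge0$ and real $r_{i,t},\text{EV}_{i,t},B^t$ subject to, for all relevant $t$ and $i\in\mathcal K_0\cup\{k\}$: $\sum_{t=t_k}^{w_i-1}r_{i,t}\ge N_i$; $r_{i,t}=r^+_{i,t}-r^-_{i,t}$, $R_{min}\le r_{i,t}\le R_{max}$; $r_{t,\text{charge}}=\sum_ir^+_{i,t}/\eta_{i,c}$, $r_{t,\text{discharge}}=\sum_i\eta_{i,dc}r^-_{i,t}$; $\text{EV}_{i,t+1}=\text{EV}_{i,t}+r_{i,t}$, $\text{EV}_{i,t_k}=\text{EV}^{i,\mathrm{ini}}$, $d_{i,\min}\le\text{EV}_{i,t}\le d_{i,\max}$; $B^{t+1}=B^t+\bar E^t\eta_{c,cs}-e_t/\eta_{d,cs}+s_t\eta_{c,cs}$, $0\le B^{t+1}\le B_{max}$, initial level $B^0$, $B^T=B^0$; $q_t-r_{t,\text{charge}}+r_{t,\text{discharge}}-x_t=s_t-e_t$; $\sum_{t=t_k}^{w_i-1}(r^+_{i,t}+r^-_{i,t})-N_i\le BU_i$. An EV takes part only before its deadline. *)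

theory Defs
  imports "HOL-Probability.Probability"
begin

text \<open>
  A contract is a triple \<open>(l, t, b)\<close>: energy, deadline, maximum additional battery utilization.
\<close>

type_synonym contract = "nat \<times> nat \<times> nat"

text \<open>
  The situation at the arrival time \<open>t\<^sub>k\<close> of user \<open>k\<close>. The fields \<open>demand\<close>, \<open>deadline\<close>,
  \<open>allowance\<close> are \<open>N\<^sub>i\<close>, \<open>w\<^sub>i\<close>, \<open>BU\<^sub>i\<close>; their values at the arriving user are irrelevant
  until a contract is signed (see \<open>with_contract\<close>).
\<close>

record 'i station =
  arrival :: nat                      \<comment> \<open>\<open>t\<^sub>k\<close>\<close>
  horizon :: nat                      \<comment> \<open>\<open>T\<close>\<close>
  max_energy :: nat                   \<comment> \<open>\<open>L\<close>\<close>
  max_util :: nat                     \<comment> \<open>\<open>BU\<^sub>m\<^sub>a\<^sub>x\<close>\<close>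
  vehicles :: "'i set"                \<comment> \<open>\<open>K\<^sub>0\<close>\<close>
  user :: 'i                          \<comment> \<open>\<open>k\<close>\<close>
  demand :: "'i \<Rightarrow> real"
  deadline :: "'i \<Rightarrow> nat"
  allowance :: "'i \<Rightarrow> real"
  eff_c :: "'i \<Rightarrow> real"               \<comment> \<open>EV charging efficiency\<close>
  eff_dc :: "'i \<Rightarrow> real"              \<comment> \<open>EV discharging efficiency\<close>
  ev_ini :: "'i \<Rightarrow> real"
  ev_min :: "'i \<Rightarrow> real"
  ev_max :: "'i \<Rightarrow> real"
  rate_min :: real
  rate_max :: real
  harvest :: "nat \<Rightarrow> real"
  capacity :: real                    \<comment> \<open>\<open>B\<^sub>m\<^sub>a\<^sub>x\<close>\<close>
  storage_ini :: real                 \<comment> \<open>\<open>B\<^sup>0\<close>\<close>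
  eff_c_cs :: real
  eff_d_cs :: real
  buy_cost :: "nat \<Rightarrow> real"           \<comment> \<open>\<open>c\<^sub>t\<close>\<close>
  sell_gain :: "nat \<Rightarrow> real"          \<comment> \<open>\<open>g\<^sub>t\<close>\<close>

definition valid_station :: "'i station \<Rightarrow> bool" where
  "valid_station S \<longleftrightarrow>
     finite (vehicles S) \<and> user S \<notin> vehicles S \<and>
     arrival S < horizon S \<and> 1 \<le> max_energy S \<and>
     (\<forall>i \<in> insert (user S) (vehicles S). eff_c S i \<le> 1 \<and> eff_dc S i \<le> 1) \<and>
     (\<forall>t \<in> {arrival S..<horizon S}. sell_gain S t \<le> buy_cost S t)"

definition contracts :: "'i station \<Rightarrow> contract set" where
  "contracts S = {1..max_energy S} \<times> {arrival S + 1..horizon S} \<times> {0..max_util S}"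

text \<open>The decision variables of the linear program.\<close>

record 'i schedule =
  buy :: "nat \<Rightarrow> real"                \<comment> \<open>\<open>q\<^sub>t\<close>\<close>
  sell :: "nat \<Rightarrow> real"               \<comment> \<open>\<open>x\<^sub>t\<close>\<close>
  release :: "nat \<Rightarrow> real"            \<comment> \<open>\<open>e\<^sub>t\<close>\<close>
  store :: "nat \<Rightarrow> real"              \<comment> \<open>\<open>s\<^sub>t\<close>\<close>
  rate_plus :: "'i \<Rightarrow> nat \<Rightarrow> real"
  rate_minus :: "'i \<Rightarrow> nat \<Rightarrow> real"
  rate :: "'i \<Rightarrow> nat \<Rightarrow> real"
  ev_level :: "'i \<Rightarrow> nat \<Rightarrow> real"
  storage :: "nat \<Rightarrow> real"            \<comment> \<open>\<open>B\<^sup>t\<close>\<close>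

text \<open>The vehicles taking part at time \<open>t\<close>: those whose deadline has not been reached.\<close>

definition active :: "'i station \<Rightarrow> nat \<Rightarrow> 'i set" where
  "active S t = {i \<in> vehicles S. t < deadline S i}"

definition total_charge :: "'i station \<Rightarrow> 'i schedule \<Rightarrow> nat \<Rightarrow> real" where
  "total_charge S z t = (\<Sum>i \<in> active S t. rate_plus z i t / eff_c S i)"

definition total_discharge :: "'i station \<Rightarrow> 'i schedule \<Rightarrow> nat \<Rightarrow> real" where
  "total_discharge S z t = (\<Sum>i \<in> active S t. eff_dc S i * rate_minus z i t)"

definition vehicle_feasible :: "'i station \<Rightarrow> 'i schedule \<Rightarrow> 'i \<Rightarrow> bool" where
  "vehicle_feasible S z i \<longleftrightarrow>
     (\<Sum>t = arrival S..<deadline S i. rate z i t) \<ge> demand S i \<and>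
     (\<forall>t \<in> {arrival S..<deadline S i}.
        0 \<le> rate_plus z i t \<and> 0 \<le> rate_minus z i t \<and>
        rate z i t = rate_plus z i t - rate_minus z i t \<and>
        rate_min S \<le> rate z i t \<and> rate z i t \<le> rate_max S \<and>
        ev_level z i (t + 1) = ev_level z i t + rate z i t) \<and>
     ev_level z i (arrival S) = ev_ini S i \<and>
     (\<forall>t \<in> {arrival S..deadline S i}. ev_min S i \<le> ev_level z i t \<and> ev_level z i t \<le> ev_max S i) \<and>
     (\<Sum>t = arrival S..<deadline S i. rate_plus z i t + rate_minus z i t) - demand S i
       \<le> allowance S i"

definition storage_feasible :: "'i station \<Rightarrow> 'i schedule \<Rightarrow> bool" where
  "storage_feasible S z \<longleftrightarrow>
     (\<forall>t \<in> {arrival S..<horizon S}.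
        0 \<le> buy z t \<and> 0 \<le> sell z t \<and> 0 \<le> release z t \<and> 0 \<le> store z t \<and>
        storage z (t + 1) = storage z t + harvest S t * eff_c_cs S
          - release z t / eff_d_cs S + store z t * eff_c_cs S \<and>
        0 \<le> storage z (t + 1) \<and> storage z (t + 1) \<le> capacity S \<and>
        buy z t - total_charge S z t + total_discharge S z t - sell z t = store z t - release z t) \<and>
     storage z (arrival S) = storage_ini S \<and> storage z (horizon S) = storage_ini S"

definition feasible :: "'i station \<Rightarrow> 'i schedule \<Rightarrow> bool" where
  "feasible S z \<longleftrightarrow> storage_feasible S z \<and> (\<forall>i \<in> vehicles S. vehicle_feasible S z i)"

definition cost :: "'i station \<Rightarrow> 'i schedule \<Rightarrow> real" where
  "cost S z = (\<Sum>t = arrival S..<horizon S. buy_cost S t * buy z t - sell_gain S t * sell z t)"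

text \<open>
  The infimum over the empty set is \<open>\<infinity>\<close>, the value of an infeasible program.
\<close>

definition opt_value :: "'i station \<Rightarrow> ereal" where
  "opt_value S = (INF z \<in> {z. feasible S z}. ereal (cost S z))"

fun with_contract :: "'i station \<Rightarrow> contract \<Rightarrow> 'i station" where
  "with_contract S (l, t, b) =
     S\<lparr>vehicles := insert (user S) (vehicles S),
       demand := (demand S)(user S := real l),
       deadline := (deadline S)(user S := t),
       allowance := (allowance S)(user S := real b)\<rparr>"

text \<open>The values \<open>v\<close> of a contract and \<open>v\<^sub>-\<^sub>k\<close> of no contract with the arriving user.\<close>

definition v_contract :: "'i station \<Rightarrow> contract \<Rightarrow> ereal" where
  "v_contract S c = opt_value (with_contract S c)"

definition v_none :: "'i station \<Rightarrow> ereal" where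
  "v_none S = opt_value S"

text \<open>
  A price is a real number or \<open>\<infinity>\<close>; the latter means that the contract is never accepted, and it
  is what \<open>v - v\<^sub>-\<^sub>k + \<zeta>\<close> yields for an infeasible contract.
\<close>

definition pricing :: "'i station \<Rightarrow> (contract \<Rightarrow> ereal) \<Rightarrow> bool" where
  "pricing S p \<longleftrightarrow> (\<forall>c \<in> contracts S. p c \<noteq> -\<infinity>)"

definition payoff :: "(contract \<Rightarrow> 'a \<Rightarrow> real) \<Rightarrow> (contract \<Rightarrow> ereal) \<Rightarrow> contract \<Rightarrow> 'a \<Rightarrow> ereal" where
  "payoff U p c \<omega> = ereal (U c \<omega>) - p c"

definition max_payoff ::
    "'i station \<Rightarrow> (contract \<Rightarrow> 'a \<Rightarrow> real) \<Rightarrow> (contract \<Rightarrow> ereal) \<Rightarrow> 'a \<Rightarrow> ereal" where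
  "max_payoff S U p \<omega> = Max ((\<lambda>c. payoff U p c \<omega>) ` contracts S)"

text \<open>
  \<open>D \<omega>\<close> is the decision of the user in outcome \<open>\<omega>\<close>, where \<open>None\<close> means rejection of all contracts.
  The decision is a random variable on \<open>M\<close> and need not be a function of the utilities: \<open>M\<close> is an
  arbitrary probability space, so it may also carry a lottery by which the user
  picks one of several contracts of maximum payoff, with any weights.
\<close>

definition user_decision ::
    "'a measure \<Rightarrow> 'i station \<Rightarrow> (contract \<Rightarrow> 'a \<Rightarrow> real) \<Rightarrow> (contract \<Rightarrow> ereal) \<Rightarrow>
     ('a \<Rightarrow> contract option) \<Rightarrow> bool" where
  "user_decision M S U p D \<longleftrightarrow>
     D \<in> measurable M (count_space UNIV) \<and>
     (\<forall>\<omega> \<in> space M.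
        case D \<omega> of
          None \<Rightarrow> max_payoff S U p \<omega> < 0
        | Some c \<Rightarrow> c \<in> contracts S \<and> payoff U p c \<omega> = max_payoff S U p \<omega> \<and>
                    0 \<le> max_payoff S U p \<omega>)"

text \<open>
  Extended-real arithmetic: a contract priced at \<open>\<infinity>\<close> is accepted with probability \<open>0\<close> and its term
  vanishes since \<open>x * 0 = 0\<close> for all \<open>x\<close>; an infeasible contract sold at a finite price
  with positive probability contributes \<open>-\<infinity>\<close>.
\<close>

definition expected_profit ::
    "'a measure \<Rightarrow> 'i station \<Rightarrow> (contract \<Rightarrow> ereal) \<Rightarrow> ('a \<Rightarrow> contract option) \<Rightarrow> ereal" where
  "expected_profit M S p D =
     (\<Sum>c \<in> contracts S.
        (p c - v_contract S c + v_none S) * ereal \<P>(\<omega> in M. D \<omega> = Some c))"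

definition margin_revenue :: "'a measure \<Rightarrow> 'i station \<Rightarrow> (contract \<Rightarrow> 'a \<Rightarrow> real) \<Rightarrow> real \<Rightarrow> real" where
  "margin_revenue M S U \<beta> =
     \<beta> * Max ((\<lambda>c. \<P>(\<omega> in M. ereal (U c \<omega>) \<ge> ereal \<beta> + v_contract S c - v_none S)) ` contracts S)"

text \<open>
  If \<open>v\<^sub>-\<^sub>k\<close> is infinite, or some contract has value \<open>-\<infinity>\<close>, then the maximum in
  \<open>margin_revenue\<close> is \<open>0\<close> for all \<open>\<beta>\<close> or \<open>1\<close> for all \<open>\<beta>\<close>, so the set below has no
  greatest element. The existence of \<open>\<zeta>\<close> thus entails that these values are proper.
\<close>

definition optimal_margins :: "'a measure \<Rightarrow> 'i station \<Rightarrow> (contract \<Rightarrow> 'a \<Rightarrow> real) \<Rightarrow> real set" where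
  "optimal_margins M S U = {\<gamma>. is_arg_max (margin_revenue M S U) (\<lambda>\<beta>. 0 \<le> \<beta>) \<gamma>}"

end

theory Submission imports Defs begin

text \<open>
  As the random part of the utilities is common to all contracts, the set of contracts of maximum
  payoff is determined by the prices alone: these are the maximisers of \<open>Y - p\<close>. Let \<open>q\<close> be the
  maximum and let \<open>A\<close> be the greatest surplus \<open>Y - v + v\<^sub>-\<^sub>k\<close> of a contract. The user accepts
  iff \<open>X + q \<ge> 0\<close>, and then the station gains at most \<open>A - q\<close>. So the expected profit is at most
  \<open>\<beta> Pr(X + A \<ge> \<beta>)\<close> with \<open>\<beta> = A - q\<close>, which is the quantity maximised by \<open>\<zeta>\<close>; the proposed
  prices have \<open>q = A - \<zeta>\<close> and attain it.
\<close>

lemma finite_contracts: "finite (contracts S)"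
  by (simp add: contracts_def)

lemma contracts_nonempty: "valid_station S \<Longrightarrow> contracts S \<noteq> {}"
  by (auto simp: contracts_def valid_station_def)

lemma margin_revenue_le_optimal:
  assumes "\<zeta> \<in> optimal_margins M S U" "0 \<le> \<beta>"
  shows "margin_revenue M S U \<beta> \<le> margin_revenue M S U \<zeta>"
  using assms by (auto simp: optimal_margins_def is_arg_max_def not_less)

lemma optimal_margins_nonneg: "\<zeta> \<in> optimal_margins M S U \<Longrightarrow> 0 \<le> \<zeta>"
  by (simp add: optimal_margins_def is_arg_max_def)

section \<open>User decisions under additive utility\<close>

locale additive_utility = prob_space M for M :: "'a measure" +
  fixes S :: "'i station" and U :: "contract \<Rightarrow> 'a \<Rightarrow> real"
    and Y :: "contract \<Rightarrow> real" and X :: "'a \<Rightarrow> real"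
  assumes valid: "valid_station S"
    and X_measurable [measurable]: "X \<in> borel_measurable M"
    and utility: "\<And>c \<omega>. c \<in> contracts S \<Longrightarrow> \<omega> \<in> space M \<Longrightarrow> U c \<omega> = Y c + X \<omega>"
begin

text \<open>Deterministic part of the maximum payoff. It is extended-real since pricing all
  contracts at \<open>\<infinity>\<close> yields \<open>-\<infinity>\<close>.\<close>

definition net_utility :: "(contract \<Rightarrow> ereal) \<Rightarrow> ereal" where
  "net_utility p = Max ((\<lambda>c. ereal (Y c) - p c) ` contracts S)"

lemma payoff_eq:
  assumes "c \<in> contracts S" "\<omega> \<in> space M"
  shows "payoff U p c \<omega> = ereal (Y c) - p c + ereal (X \<omega>)"
  using utility[OF assms] by (cases "p c") (simp_all add: payoff_def)

lemma max_payoff_eq: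
  assumes "\<omega> \<in> space M"
  shows "max_payoff S U p \<omega> = net_utility p + ereal (X \<omega>)"
proof -
  \<comment> \<open>Adding the finite common term is monotone, hence commutes with
    \<open>Max\<close>.\<close>
  have "mono (\<lambda>x. x + ereal (X \<omega>))"
    by (intro monoI add_right_mono)
  then have "net_utility p + ereal (X \<omega>)
      = Max ((\<lambda>x. x + ereal (X \<omega>)) ` (\<lambda>c. ereal (Y c) - p c) ` contracts S)"
    unfolding net_utility_def
    by (rule mono_Max_commute) (use finite_contracts contracts_nonempty[OF valid] in auto)
  also have "\<dots> = max_payoff S U p \<omega>"
    unfolding max_payoff_def image_image using assms
    by (intro arg_cong[where f = Max] image_cong) (simp_all add: payoff_eq)
  finally show ?thesis ..
qed

lemma net_utility_neq_infinity:
  assumes "pricing S p"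
  shows "net_utility p \<noteq> \<infinity>"
proof -
  have "net_utility p \<in> (\<lambda>c. ereal (Y c) - p c) ` contracts S"
    unfolding net_utility_def
    by (rule Max_in) (use finite_contracts contracts_nonempty[OF valid] in auto)
  then obtain c where "c \<in> contracts S" "net_utility p = ereal (Y c) - p c"
    by auto
  moreover from this assms have "p c \<noteq> -\<infinity>"
    by (simp add: pricing_def)
  ultimately show ?thesis
    by (cases "p c") simp_all
qed

text \<open>The finite term \<open>X \<omega>\<close> cancels when payoffs are compared, so all
  contracts accepted in some outcome share one value of \<open>Y c - p c\<close>, whatever the
  outcome.\<close>

lemma decision_Some:
  assumes "user_decision M S U p D" "\<omega> \<in> space M" "D \<omega> = Some c"
  shows "c \<in> contracts S" "ereal (Y c) - p c = net_utility p" "0 \<le> net_utility p + ereal (X \<omega>)"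
proof -
  have *: "c \<in> contracts S \<and> payoff U p c \<omega> = max_payoff S U p \<omega> \<and> 0 \<le> max_payoff S U p \<omega>"
    using assms by (auto simp: user_decision_def dest!: bspec)
  then show "c \<in> contracts S" "0 \<le> net_utility p + ereal (X \<omega>)"
    using max_payoff_eq assms(2) by auto
  have "ereal (Y c) - p c + ereal (X \<omega>) = net_utility p + ereal (X \<omega>)"
    using * payoff_eq[of c \<omega> p] max_payoff_eq[OF assms(2), of p] assms(2) by simp
  then show "ereal (Y c) - p c = net_utility p"
    by (cases "ereal (Y c) - p c"; cases "net_utility p") auto
qed

lemma decision_None_iff:
  assumes "user_decision M S U p D" "\<omega> \<in> space M"
  shows "D \<omega> = None \<longleftrightarrow> net_utility p + ereal (X \<omega>) < 0"
  using assms decision_Some(3)[OF assms] max_payoff_eq[OF assms(2)]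
  by (cases "D \<omega>") (auto simp: user_decision_def not_less dest!: bspec)

text \<open>The choice among tied contracts drops out of the sum: the acceptance events are
  disjoint, and their union is the event that the maximum payoff is nonnegative.\<close>

lemma sum_prob_decision:
  assumes "user_decision M S U p D"
  shows "(\<Sum>c\<in>contracts S. \<P>(\<omega> in M. D \<omega> = Some c))
      = \<P>(\<omega> in M. 0 \<le> net_utility p + ereal (X \<omega>))"
proof -
  have [measurable]: "D \<in> measurable M (count_space UNIV)"
    using assms by (simp add: user_decision_def)
  have "(\<Sum>c\<in>contracts S. \<P>(\<omega> in M. D \<omega> = Some c))
      = prob (\<Union>c\<in>contracts S. {\<omega> \<in> space M. D \<omega> = Some c})"
    by (rule finite_measure_finite_Union[symmetric])
      (auto simp: finite_contracts disjoint_family_on_def)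
  also have "(\<Union>c\<in>contracts S. {\<omega> \<in> space M. D \<omega> = Some c})
      = {\<omega> \<in> space M. 0 \<le> net_utility p + ereal (X \<omega>)}"
    using decision_Some[OF assms] decision_None_iff[OF assms] by (fastforce simp: not_less)
  finally show ?thesis .
qed

lemma prob_decision_nonzeroE:
  assumes "\<P>(\<omega> in M. D \<omega> = Some c) \<noteq> 0"
  obtains \<omega> where "\<omega> \<in> space M" "D \<omega> = Some c"
  using assms by (metis (mono_tags, lifting) Collect_empty_eq measure_empty)

section \<open>Finiteness of the program values\<close>

text \<open>
  If a value is improper, then \<open>margin_revenue\<close> is constantly \<open>0\<close> or the identity.
\<close>

lemma values_proper:
  assumes opt: "\<zeta> \<in> optimal_margins M S U"
    and greatest: "\<forall>\<gamma>\<in>optimal_margins M S U. \<gamma> \<le> \<zeta>"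
  shows "\<bar>v_none S\<bar> \<noteq> \<infinity>" "\<And>c. c \<in> contracts S \<Longrightarrow> v_contract S c \<noteq> -\<infinity>"
    "\<exists>c\<in>contracts S. v_contract S c \<noteq> \<infinity>"
proof -
  let ?P = "\<lambda>\<beta> c. \<P>(\<omega> in M. ereal (U c \<omega>) \<ge> ereal \<beta> + v_contract S c - v_none S)"
  have not_zero: False if "\<And>\<beta> c. c \<in> contracts S \<Longrightarrow> ?P \<beta> c = 0"
  proof -
    have "(\<lambda>c. ?P \<beta> c) ` contracts S = {0}" for \<beta>
      using that contracts_nonempty[OF valid] by auto
    then have "margin_revenue M S U \<beta> = 0" for \<beta>
      by (simp add: margin_revenue_def)
    \<comment> \<open>A constant revenue makes every nonnegative margin optimal, so none is
      greatest.\<close>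
    then have "\<zeta> + 1 \<in> optimal_margins M S U"
      using optimal_margins_nonneg[OF opt] by (simp add: optimal_margins_def is_arg_max_def)
    from bspec[OF greatest this] show False by simp
  qed
  have not_one: False if "c \<in> contracts S" "\<And>\<beta>. ?P \<beta> c = 1" for c
  proof -
    have "Max ((\<lambda>c. ?P \<beta> c) ` contracts S) = 1" for \<beta>
      using that finite_contracts by (intro Max_eqI) (auto simp: image_iff intro: bexI[of _ c])
    then have "margin_revenue M S U \<beta> = \<beta>" for \<beta>
      by (simp add: margin_revenue_def)
    then show False
      using margin_revenue_le_optimal[OF opt, of "\<zeta> + 1"] optimal_margins_nonneg[OF opt]
      by simp
  qed
  \<comment> \<open>Subtracting \<open>-\<infinity>\<close> makes every threshold
    \<open>\<infinity>\<close>, even for a contract of value \<open>-\<infinity>\<close>.\<close>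
  have "v_none S \<noteq> -\<infinity>"
    using not_zero by auto
  moreover have "v_none S \<noteq> \<infinity>"
  proof
    assume inf: "v_none S = \<infinity>"
    show False
    proof (cases "\<exists>c\<in>contracts S. v_contract S c \<noteq> \<infinity>")
      case True
      then obtain c where c: "c \<in> contracts S" "v_contract S c \<noteq> \<infinity>" by auto
      then have "ereal \<beta> + v_contract S c - v_none S = -\<infinity>" for \<beta>
        using inf by (cases "v_contract S c") auto
      with not_one[OF c(1)] show False
        by (simp add: prob_space)
    next
      \<comment> \<open>In \<open>ereal\<close>,
        \<open>\<infinity> - \<infinity> = \<infinity>\<close>, so no threshold is ever
        reached.\<close>
      case False
      then show False
        using not_zero inf by auto
    qed
  qed
  ultimately show fin: "\<bar>v_none S\<bar> \<noteq> \<infinity>"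
    by auto
  show "v_contract S c \<noteq> -\<infinity>" if "c \<in> contracts S" for c
    using not_one[OF that] fin by (cases "v_none S") (auto simp: prob_space)
  show "\<exists>c\<in>contracts S. v_contract S c \<noteq> \<infinity>"
  proof (rule ccontr)
    assume "\<not> ?thesis"
    then have "?P \<beta> c = 0" if "c \<in> contracts S" for \<beta> c
      using that fin by (cases "v_none S") auto
    with not_zero show False by blast
  qed
qed

end

section \<open>Surplus and margin revenue for finite values\<close>

locale proper_additive_utility = additive_utility M S U Y X
  for M :: "'a measure" and S :: "'i station" and U Y X +
  fixes n :: real and w :: "contract \<Rightarrow> real"
  assumes v_none: "v_none S = ereal n"
    and v_contract: "\<And>c. c \<in> contracts S \<Longrightarrow> v_contract S c \<noteq> \<infinity> \<Longrightarrow> v_contract S c = ereal (w c)"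
    and some_feasible: "\<exists>c\<in>contracts S. v_contract S c \<noteq> \<infinity>"
begin

definition feasible_contracts :: "contract set" where
  "feasible_contracts = {c \<in> contracts S. v_contract S c \<noteq> \<infinity>}"

text \<open>The most that user and station can gain together, apart from \<open>X\<close>.
  Restricting to feasible contracts makes it a maximum of reals.\<close>

definition surplus :: real where
  "surplus = Max ((\<lambda>c. Y c - w c + n) ` feasible_contracts)"

lemma finite_feasible: "finite feasible_contracts"
  by (simp add: feasible_contracts_def finite_contracts)

lemma v_feasible: "c \<in> feasible_contracts \<Longrightarrow> v_contract S c = ereal (w c)"
  unfolding feasible_contracts_def using v_contract by blast

lemma v_infeasible: "c \<in> contracts S \<Longrightarrow> c \<notin> feasible_contracts \<Longrightarrow> v_contract S c = \<infinity>"
  by (simp add: feasible_contracts_def)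

lemma surplus_ge: "c \<in> feasible_contracts \<Longrightarrow> Y c - w c + n \<le> surplus"
  by (simp add: surplus_def finite_feasible)

lemma surplus_attained:
  obtains c where "c \<in> contracts S" "v_contract S c = ereal (w c)" "Y c - w c + n = surplus"
proof -
  have "surplus \<in> (\<lambda>c. Y c - w c + n) ` feasible_contracts"
    unfolding surplus_def
    by (rule Max_in) (use finite_feasible some_feasible in \<open>auto simp: feasible_contracts_def\<close>)
  then obtain c where c: "c \<in> feasible_contracts" "Y c - w c + n = surplus"
    by auto
  then have "c \<in> contracts S"
    by (simp add: feasible_contracts_def)
  from that[OF this v_feasible] c show ?thesis by blast
qed

text \<open>The event of a feasible contract is
  \<open>\<beta> \<le> Y c - w c + n + X \<omega>\<close>, so a contract of greatest surplus has the
  largest event; infeasible contracts have an empty one.\<close>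

lemma margin_revenue_eq: "margin_revenue M S U \<beta> = \<beta> * \<P>(\<omega> in M. \<beta> \<le> surplus + X \<omega>)"
proof -
  let ?P = "\<lambda>c. \<P>(\<omega> in M. ereal (U c \<omega>) \<ge> ereal \<beta> + v_contract S c - v_none S)"
  obtain c0 where c0: "c0 \<in> contracts S" "v_contract S c0 = ereal (w c0)" "Y c0 - w c0 + n = surplus"
    by (rule surplus_attained)
  have "Max (?P ` contracts S) = \<P>(\<omega> in M. \<beta> \<le> surplus + X \<omega>)"
  proof (rule Max_eqI)
    show "y \<le> \<P>(\<omega> in M. \<beta> \<le> surplus + X \<omega>)" if y: "y \<in> ?P ` contracts S" for y
    proof -
      obtain c where c: "c \<in> contracts S" "y = ?P c"
        using y by auto
      show ?thesis
      proof (cases "c \<in> feasible_contracts")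
        case True
        have "\<beta> \<le> surplus + X \<omega>"
          if "\<omega> \<in> space M" "ereal (U c \<omega>) \<ge> ereal \<beta> + v_contract S c - v_none S" for \<omega>
          using that(2) surplus_ge[OF True]
          unfolding v_feasible[OF True] v_none utility[OF c(1) that(1)] by auto
        then show ?thesis
          unfolding c(2) by (intro finite_measure_mono) auto
      next
        case False
        then show ?thesis using c v_none by (simp add: v_infeasible)
      qed
    qed
    have "ereal (U c0 \<omega>) \<ge> ereal \<beta> + v_contract S c0 - v_none S \<longleftrightarrow> \<beta> \<le> surplus + X \<omega>"
      if "\<omega> \<in> space M" for \<omega>
      unfolding c0(2) v_none c0(3)[symmetric] utility[OF c0(1) that] by auto
    then have "?P c0 = \<P>(\<omega> in M. \<beta> \<le> surplus + X \<omega>)"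
      by (simp cong: conj_cong)
    then show "\<P>(\<omega> in M. \<beta> \<le> surplus + X \<omega>) \<in> ?P ` contracts S"
      by (intro image_eqI[OF _ c0(1)]) (rule sym)
  qed (simp add: finite_contracts)
  then show ?thesis
    by (simp add: margin_revenue_def)
qed

section \<open>Upper bound for arbitrary prices\<close>

lemma expected_profit_le:
  assumes p: "pricing S p" and D: "user_decision M S U p D"
    and \<zeta>: "\<zeta> \<in> optimal_margins M S U"
  shows "expected_profit M S p D \<le> ereal (margin_revenue M S U \<zeta>)"
proof -
  define q where "q = real_of_ereal (net_utility p)"
  \<comment> \<open>The margin of an accepted contract is at most \<open>surplus - q\<close>. It is
    cut off at 0 because \<open>\<zeta>\<close> is optimal among nonnegative margins only.\<close>
  let ?\<beta> = "max 0 (surplus - q)"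
  \<comment> \<open>Acceptance excludes \<open>-\<infinity>\<close>. If the net utility is
    \<open>-\<infinity>\<close>, then \<open>q\<close> has the default value 0, but nothing is ever
    accepted.\<close>
  have net: "net_utility p = ereal q" if "\<omega> \<in> space M" "D \<omega> = Some c" for \<omega> c
    using decision_Some(3)[OF D that] net_utility_neq_infinity[OF p]
    by (cases "net_utility p") (auto simp: q_def)
  have term_le: "(p c - v_contract S c + v_none S) * ereal \<P>(\<omega> in M. D \<omega> = Some c)
      \<le> ereal (?\<beta> * \<P>(\<omega> in M. D \<omega> = Some c))" if c: "c \<in> contracts S" for c
  \<comment> \<open>At probability 0 the term vanishes even for an infinite margin; otherwise a
    single accepting outcome determines the price.\<close>
  proof (cases "\<P>(\<omega> in M. D \<omega> = Some c) = 0")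
    case False
    then obtain \<omega> where \<omega>: "\<omega> \<in> space M" "D \<omega> = Some c"
      by (rule prob_decision_nonzeroE)
    then have pc: "p c = ereal (Y c - q)"
      using decision_Some(2)[OF D \<omega>] net[OF \<omega>] by (cases "p c") auto
    have "p c - v_contract S c + v_none S \<le> ereal ?\<beta>"
    proof (cases "c \<in> feasible_contracts")
      case True
      from v_feasible[OF this] surplus_ge[OF this] show ?thesis
        using pc v_none by (simp add: le_max_iff_disj)
    next
      case False
      then show ?thesis using pc v_none c by (simp add: v_infeasible)
    qed
    then have "(p c - v_contract S c + v_none S) * ereal \<P>(\<omega> in M. D \<omega> = Some c)
        \<le> ereal ?\<beta> * ereal \<P>(\<omega> in M. D \<omega> = Some c)"
      by (rule ereal_mult_right_mono) simp
    then show ?thesis by (simp only: times_ereal.simps)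
  qed (simp flip: zero_ereal_def)
  have "expected_profit M S p D \<le> (\<Sum>c\<in>contracts S. ereal (?\<beta> * \<P>(\<omega> in M. D \<omega> = Some c)))"
    unfolding expected_profit_def by (rule sum_mono) (rule term_le)
  also have "\<dots> = ereal (?\<beta> * \<P>(\<omega> in M. 0 \<le> net_utility p + ereal (X \<omega>)))"
    by (simp add: sum_prob_decision[OF D, symmetric] sum_distrib_left)
  also have "?\<beta> * \<P>(\<omega> in M. 0 \<le> net_utility p + ereal (X \<omega>)) \<le> margin_revenue M S U ?\<beta>"
  proof -
    have "0 \<le> q + X \<omega>" if "0 \<le> net_utility p + ereal (X \<omega>)" for \<omega>
      using that net_utility_neq_infinity[OF p] by (cases "net_utility p") (auto simp: q_def)
    \<comment> \<open>Adding \<open>surplus - q\<close> to both sides of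
      \<open>0 \<le> q + X \<omega>\<close> turns acceptance into the event of the margin
      revenue.\<close>
    then have "\<P>(\<omega> in M. 0 \<le> net_utility p + ereal (X \<omega>)) \<le> \<P>(\<omega> in M. ?\<beta> \<le> surplus + X \<omega>)"
      if "q \<le> surplus"
      using that by (intro finite_measure_mono) (force simp: max_def)+
    \<comment> \<open>For \<open>q\<close> above \<open>surplus\<close> both sides are 0.\<close>
    then show ?thesis
      by (cases "q \<le> surplus") (auto simp: margin_revenue_eq max_def intro: mult_left_mono)
  qed
  also have "margin_revenue M S U ?\<beta> \<le> margin_revenue M S U \<zeta>"
    by (rule margin_revenue_le_optimal[OF \<zeta>]) simp
  finally show ?thesis by simp
qed

section \<open>Profit of the proposed prices\<close>

lemma net_utility_margin_pricing:
  "net_utility (\<lambda>c. v_contract S c - v_none S + ereal \<zeta>) = ereal (surplus - \<zeta>)"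
  unfolding net_utility_def
proof (rule Max_eqI)
  fix y assume "y \<in> (\<lambda>c. ereal (Y c) - (v_contract S c - v_none S + ereal \<zeta>)) ` contracts S"
  then obtain c where c: "c \<in> contracts S" "y = ereal (Y c) - (v_contract S c - v_none S + ereal \<zeta>)"
    by auto
  then show "y \<le> ereal (surplus - \<zeta>)"
    using v_none v_feasible[of c] v_infeasible[of c] surplus_ge[of c]
    by (cases "c \<in> feasible_contracts") auto
next
  obtain c where "c \<in> contracts S" "v_contract S c = ereal (w c)" "Y c - w c + n = surplus"
    by (rule surplus_attained)
  then show "ereal (surplus - \<zeta>)
      \<in> (\<lambda>c. ereal (Y c) - (v_contract S c - v_none S + ereal \<zeta>)) ` contracts S"
    using v_none by (intro image_eqI[of _ _ c]) auto
qed (simp add: finite_contracts)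

text \<open>Every contract accepted with positive probability earns exactly \<open>\<zeta>\<close>,
  so the profit is \<open>\<zeta>\<close> times the acceptance probability, however ties are
  broken.\<close>

lemma expected_profit_margin_pricing:
  assumes D: "user_decision M S U (\<lambda>c. v_contract S c - v_none S + ereal \<zeta>) D"
  shows "expected_profit M S (\<lambda>c. v_contract S c - v_none S + ereal \<zeta>) D
      = ereal (margin_revenue M S U \<zeta>)"
proof -
  let ?p = "\<lambda>c. v_contract S c - v_none S + ereal \<zeta>"
  have "(?p c - v_contract S c + v_none S) * ereal \<P>(\<omega> in M. D \<omega> = Some c)
      = ereal (\<zeta> * \<P>(\<omega> in M. D \<omega> = Some c))" if c: "c \<in> contracts S" for c
  proof (cases "\<P>(\<omega> in M. D \<omega> = Some c) = 0")
    case False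
    then obtain \<omega> where "\<omega> \<in> space M" "D \<omega> = Some c"
      by (rule prob_decision_nonzeroE)
    then have "ereal (Y c) - ?p c = ereal (surplus - \<zeta>)"
      using decision_Some(2)[OF D] net_utility_margin_pricing by simp
    \<comment> \<open>An infeasible contract has price \<open>\<infinity>\<close>, which the finite
      net utility rules out.\<close>
    then have "v_contract S c = ereal (w c)"
      using v_none v_feasible[of c] v_infeasible[OF c] by (cases "c \<in> feasible_contracts") auto
    then show ?thesis using v_none by simp
  qed (simp flip: zero_ereal_def)
  then have "expected_profit M S ?p D = ereal (\<zeta> * \<P>(\<omega> in M. 0 \<le> net_utility ?p + ereal (X \<omega>)))"
    by (simp add: expected_profit_def sum_prob_decision[OF D, symmetric] sum_distrib_left)
  also have "\<dots> = ereal (margin_revenue M S U \<zeta>)"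
    by (simp add: net_utility_margin_pricing margin_revenue_eq le_diff_eq diff_add_eq)
  finally show ?thesis .
qed

end

theorem theorem6:
  fixes S :: "'i station" and M :: "'a measure"
    and U :: "contract \<Rightarrow> 'a \<Rightarrow> real" and Y :: "contract \<Rightarrow> real" and X :: "'a \<Rightarrow> real"
    and D :: "(contract \<Rightarrow> ereal) \<Rightarrow> 'a \<Rightarrow> contract option"
    and \<zeta> :: real
  assumes "valid_station S"
    and "prob_space M"
    and "X \<in> borel_measurable M"
    and "\<And>c \<omega>. c \<in> contracts S \<Longrightarrow> \<omega> \<in> space M \<Longrightarrow> U c \<omega> = Y c + X \<omega>"
    and "\<And>p. pricing S p \<Longrightarrow> user_decision M S U p (D p)"
    and "\<zeta> \<in> optimal_margins M S U"
    and "\<And>\<gamma>. \<gamma> \<in> optimal_margins M S U \<Longrightarrow> \<gamma> \<le> \<zeta>"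
  shows "is_arg_max (\<lambda>p. expected_profit M S p (D p)) (pricing S)
           (\<lambda>c. v_contract S c - v_none S + ereal \<zeta>)"
proof -
  interpret additive_utility M S U Y X
    by (intro additive_utility.intro additive_utility_axioms.intro) (use assms in auto)
  have "\<forall>\<gamma>\<in>optimal_margins M S U. \<gamma> \<le> \<zeta>"
    using assms(7) by blast
  note proper = values_proper[OF assms(6) this]
  interpret proper_additive_utility M S U Y X "real_of_ereal (v_none S)"
      "\<lambda>c. real_of_ereal (v_contract S c)"
  proof
    show "v_none S = ereal (real_of_ereal (v_none S))"
      using proper(1) by (simp add: ereal_real)
    show "v_contract S c = ereal (real_of_ereal (v_contract S c))"
      if "c \<in> contracts S" "v_contract S c \<noteq> \<infinity>" for c
      using proper(2)[OF that(1)] that(2) by (cases "v_contract S c") auto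
  qed (rule proper(3))
  let ?p = "\<lambda>c. v_contract S c - v_none S + ereal \<zeta>"
  \<comment> \<open>The price \<open>\<infinity>\<close> of infeasible contracts is admissible;
    \<open>-\<infinity>\<close> cannot occur as the values are proper.\<close>
  have "pricing S ?p"
    unfolding pricing_def
  proof
    fix c assume "c \<in> contracts S"
    from proper(2)[OF this] proper(1) show "?p c \<noteq> -\<infinity>"
      by (cases "v_contract S c"; cases "v_none S") auto
  qed
  \<comment> \<open>The margin revenue at \<open>\<zeta>\<close> bounds the profit of every pricing
    and is attained by \<open>?p\<close>.\<close>
  then show ?thesis
    using expected_profit_le[OF _ assms(5,6)] expected_profit_margin_pricing assms(5)
    by (auto simp: is_arg_max_def not_less)
qed

end
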